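(* Let $G$ be a connected split graph with at least one edge, with a fixed partition $V(G)=C\sqcup I$ where $C$ induces a clique and $I$ is an independent set. Let $m=|I|$, let $a_{\max}=\max\{|I\setminus N_G(c)| : c\in C\}$ and $\delta_I=\min\{|N_G(c)\cap I| : c\in C\}$. Then $$\alpha(G)=\max\bigl(m,\ 1+a_{\max}\bigr)=\max\bigl(m,\ 1+m-\delta_I\bigr).$$
   Context: A split graph is a graph whose vertex set admits a partition $C\sqcup I$ with $C$ inducing a clique and $I$ inducing an independent set; $N_G(c)$ is the set of neighbors of $c$, and $\alpha(G)$ is the independence number of $G$. *)

theory Defs
  imports "Graph_Theory.Graph_Theory"
begin

text \<open>
  A finite simple graph is a symmetric digraph without loops or parallel arcs, as in the
  locale \<^locale>\<open>graph\<close>; each undirected edge is a pair of opposite arcs.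
\<close>

definition neighborhood :: "('a, 'b) pre_digraph \<Rightarrow> 'a \<Rightarrow> 'a set" where
  "neighborhood G c = {v \<in> verts G. c \<rightarrow>\<^bsub>G\<^esub> v}"

definition clique :: "('a, 'b) pre_digraph \<Rightarrow> 'a set \<Rightarrow> bool" where
  "clique G S \<longleftrightarrow> S \<subseteq> verts G \<and> (\<forall>u\<in>S. \<forall>v\<in>S. u \<noteq> v \<longrightarrow> u \<rightarrow>\<^bsub>G\<^esub> v)"

definition independent_set :: "('a, 'b) pre_digraph \<Rightarrow> 'a set \<Rightarrow> bool" where
  "independent_set G S \<longleftrightarrow> S \<subseteq> verts G \<and> (\<forall>u\<in>S. \<forall>v\<in>S. \<not> u \<rightarrow>\<^bsub>G\<^esub> v)"

definition independence_number :: "('a, 'b) pre_digraph \<Rightarrow> nat" where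
  "independence_number G = Max (card ` {S. independent_set G S})"

text \<open>
  Either part may be empty. For a graph with an edge the clique part cannot be, so the
  maximum and minimum over \<open>C\<close> below are then taken over nonempty finite sets.
\<close>

definition split_partition :: "('a, 'b) pre_digraph \<Rightarrow> 'a set \<Rightarrow> 'a set \<Rightarrow> bool" where
  "split_partition G C I \<longleftrightarrow>
     verts G = C \<union> I \<and> C \<inter> I = {} \<and> clique G C \<and> independent_set G I"

definition a_max :: "('a, 'b) pre_digraph \<Rightarrow> 'a set \<Rightarrow> 'a set \<Rightarrow> nat" where
  "a_max G C I = Max ((\<lambda>c. card (I - neighborhood G c)) ` C)"

definition delta_I :: "('a, 'b) pre_digraph \<Rightarrow> 'a set \<Rightarrow> 'a set \<Rightarrow> nat" where
  "delta_I G C I = Min ((\<lambda>c. card (neighborhood G c \<inter> I)) ` C)"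

end

theory Submission
  imports Defs
begin

text \<open>
  An independent set meets the clique \<open>C\<close> in at most one vertex. If it avoids \<open>C\<close>, it lies in
  \<open>I\<close>, and \<open>I\<close> itself is the best choice, of size \<open>m\<close>. If it contains \<open>c \<in> C\<close>, the rest of it
  lies in \<open>I\<close> and misses every neighbor of \<open>c\<close>, so the best choice is
  \<open>{c} \<union> (I \<setminus> N(c))\<close>, of size \<open>1 + |I \<setminus> N(c)|\<close> (lemmas
  \<open>card_independent_set_le\<close> and \<open>independent_set_insert_non_neighbors\<close>). Maximizing over all
  choices gives the first formula. The second one is the first rewritten: since
  \<open>|I \<setminus> N(c)| = m - |N(c) \<inter> I|\<close>, the vertex of \<open>C\<close> with most non-neighbors in \<open>I\<close> is the one
  with fewest neighbors there (lemma \<open>a_max_plus_delta_I\<close>).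
\<close>

lemma independent_set_meets_clique_once:
  assumes "clique G C" and "independent_set G S"
    and "u \<in> S \<inter> C" and "v \<in> S \<inter> C"
  shows "u = v"
  using assms unfolding clique_def independent_set_def by blast

lemma (in fin_digraph) finite_independent_sets: "finite {S. independent_set G S}"
  by (rule finite_subset[of _ "Pow (verts G)"]) (auto simp: independent_set_def)

lemma (in fin_digraph) card_le_independence_number:
  assumes "independent_set G S"
  shows "card S \<le> independence_number G"
  unfolding independence_number_def
  using assms finite_independent_sets by (intro Max_ge) auto

lemma (in fin_digraph) independence_number_le:
  assumes "\<And>S. independent_set G S \<Longrightarrow> card S \<le> k"
  shows "independence_number G \<le> k"
proof -
  have "independent_set G {}"
    by (simp add: independent_set_def)
  then show ?thesis
    unfolding independence_number_def
    using assms finite_independent_sets by (subst Max_le_iff) auto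
qed

text \<open>Every arc has an end in the clique part, since the other part spans no arc.\<close>

lemma (in wf_digraph) split_partition_clique_nonempty:
  assumes "split_partition G C I" and "arcs G \<noteq> {}"
  shows "C \<noteq> {}"
proof
  assume "C = {}"
  with assms(1) have "verts G = I" and "independent_set G I"
    by (auto simp: split_partition_def)
  moreover from assms(2) obtain e where "e \<in> arcs G"
    by blast
  ultimately show False
    unfolding independent_set_def
    using in_arcs_imp_in_arcs_ends tail_in_verts head_in_verts by metis
qed

lemma (in graph) independent_set_insert_non_neighbors:
  assumes "independent_set G I" and "c \<in> verts G"
  shows "independent_set G (insert c (I - neighborhood G c))"
proof -
  have "\<not> c \<rightarrow>\<^bsub>G\<^esub> v \<and> \<not> v \<rightarrow>\<^bsub>G\<^esub> c" if "v \<in> I - neighborhood G c" for v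
    using that assms(1) graph_symmetric[of v c]
    by (auto simp: neighborhood_def independent_set_def)
  moreover have "\<not> c \<rightarrow>\<^bsub>G\<^esub> c"
    using adj_not_same by blast
  ultimately show ?thesis
    using assms by (auto simp: independent_set_def)
qed

lemma (in fin_digraph) card_independent_set_le:
  assumes split: "split_partition G C I" and S: "independent_set G S"
  shows "card S \<le> max (card I) (1 + a_max G C I)"
proof -
  have verts: "verts G = C \<union> I" and clique: "clique G C"
    using split by (auto simp: split_partition_def)
  have finite: "finite C" "finite I"
    using verts finite_verts by (metis finite_Un)+
  show ?thesis
  proof (cases "S \<inter> C = {}")
    case True
    then have "S \<subseteq> I"
      using S verts by (auto simp: independent_set_def)
    then show ?thesis
      using finite by (simp add: card_mono le_max_iff_disj)
  next
    case False
    then obtain c where c: "c \<in> S" "c \<in> C"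
      by blast
    have "S \<subseteq> insert c (I - neighborhood G c)"
    proof
      fix v assume v: "v \<in> S"
      show "v \<in> insert c (I - neighborhood G c)"
      proof (cases "v \<in> C")
        case True
        then show ?thesis
          using independent_set_meets_clique_once[OF clique S] v c by blast
      next
        case False
        then show ?thesis
          using v c S verts by (auto simp: independent_set_def neighborhood_def)
      qed
    qed
    then have "card S \<le> card (insert c (I - neighborhood G c))"
      using finite by (intro card_mono) auto
    also have "\<dots> \<le> 1 + card (I - neighborhood G c)"
      using finite by (simp add: card_insert_if)
    also have "\<dots> \<le> 1 + a_max G C I"
      unfolding a_max_def using finite c by simp
    finally show ?thesis
      by simp
  qed
qed

lemma (in graph) independence_number_split:
  assumes split: "split_partition G C I" and "C \<noteq> {}"
  shows "independence_number G = max (card I) (1 + a_max G C I)"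
proof (rule antisym)
  show "independence_number G \<le> max (card I) (1 + a_max G C I)"
    using card_independent_set_le[OF split] by (rule independence_number_le)
next
  have verts: "verts G = C \<union> I" and disj: "C \<inter> I = {}" and indep: "independent_set G I"
    using split by (auto simp: split_partition_def)
  have finite: "finite C" "finite I"
    using verts finite_verts by (metis finite_Un)+
  have "a_max G C I \<in> (\<lambda>c. card (I - neighborhood G c)) ` C"
    unfolding a_max_def using finite \<open>C \<noteq> {}\<close> by (intro Max_in) auto
  then obtain c where c: "c \<in> C" "a_max G C I = card (I - neighborhood G c)"
    by blast
  have "1 + a_max G C I = card (insert c (I - neighborhood G c))"
    using c disj finite by (subst card_insert_disjoint) auto
  also have "\<dots> \<le> independence_number G"
    using c verts indep
    by (intro card_le_independence_number independent_set_insert_non_neighbors) auto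
  finally show "max (card I) (1 + a_max G C I) \<le> independence_number G"
    using card_le_independence_number[OF indep] by simp
qed

lemma a_max_plus_delta_I:
  assumes "finite C" and "C \<noteq> {}" and "finite I"
  shows "a_max G C I + delta_I G C I = card I"
proof -
  let ?non = "\<lambda>c. card (I - neighborhood G c)"
  let ?nbr = "\<lambda>c. card (neighborhood G c \<inter> I)"
  have split: "?non c + ?nbr c = card I" for c
    using card_Int_Diff[OF \<open>finite I\<close>, of "neighborhood G c"] by (simp add: Int_commute)
  have "a_max G C I \<in> ?non ` C" "delta_I G C I \<in> ?nbr ` C"
    unfolding a_max_def delta_I_def using assms by (auto intro!: Max_in Min_in)
  then obtain c d where c: "c \<in> C" "a_max G C I = ?non c"
    and d: "d \<in> C" "delta_I G C I = ?nbr d"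
    by blast
  have "?non d \<le> ?non c" "?nbr d \<le> ?nbr c"
    using c d assms unfolding a_max_def delta_I_def by (metis Max_ge Min_le finite_imageI imageI)+
  then show ?thesis
    using c d split[of c] split[of d] by linarith
qed

theorem corollary8p5:
  fixes G :: "('a, 'b) pre_digraph" and C I :: "'a set" and m :: nat
  assumes "graph G"
    and "Digraph_Component.connected G"
    and "arcs G \<noteq> {}"
    and "split_partition G C I"
    and "m = card I"
  shows "independence_number G = max m (1 + a_max G C I)
    \<and> int (independence_number G) = max (int m) (1 + int m - int (delta_I G C I))"
proof -
  interpret graph G by fact
  have nonempty: "C \<noteq> {}"
    using split_partition_clique_nonempty assms(3,4) by blast
  have "verts G = C \<union> I"
    using assms(4) by (simp add: split_partition_def)
  then have "finite C" "finite I"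
    using finite_verts by (metis finite_Un)+
  then have "a_max G C I + delta_I G C I = m"
    using a_max_plus_delta_I nonempty assms(5) by blast
  moreover have "independence_number G = max m (1 + a_max G C I)"
    using independence_number_split[OF assms(4) nonempty] assms(5) by simp
  ultimately show ?thesis
    by auto
qed

end
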